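(* Let $G$ be a finite graph and $H$ a subgraph of $G$. If $H$ is a retract of $G$, then $\sigma(H) \leq \sigma(G)$.
   Context: Surrounding Cops and Robbers on a finite simple graph $G$ with $k \geq 1$ cops and one robber: the cops first choose starting vertices (several cops may share a vertex), then the robber chooses a starting vertex not occupied by a cop, and thereafter the cops and the robber alternate moves, the cops moving first. In a move, each player may move to an adjacent vertex or stay put; the robber may never move to, or remain on, a vertex occupied by a cop, so if a cop moves onto the robber's vertex the robber is compelled to move to a neighbouring vertex not occupied by a cop. The cops win if at any time every neighbour of the robber's vertex is occupied by a cop; the robber wins if he avoids this forever. Play is with perfect information. The surrounding cop number $\sigma(G)$ is the least number of cops for which the cops have a winning strategy. $H$ is a retract of $G$ if there is a homomorphism $f : V(G) \to V(H)$ with $f(x) = x$ for all $x \in V(H)$; following the Cops and Robbers convention (Bonato–Nowakowski), graphs are regarded as reflexive, so a homomorphism maps adjacent vertices to vertices that are adjacent or equal. *)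

theory Defs
  imports "Graph_Theory.Graph_Theory"
begin

text \<open>
  A finite simple graph is a \<^locale>\<open>pair_graph\<close>: finite, loop-free, and with a symmetric arc set,
  each edge being represented by its two orientations.
\<close>

definition neighbours :: "'a pair_pre_digraph \<Rightarrow> 'a \<Rightarrow> 'a set" where
  "neighbours G v = {w. (v, w) \<in> parcs G}"

text \<open>A player may also stay put, so a step is reflexive adjacency.\<close>

definition step :: "'a pair_pre_digraph \<Rightarrow> 'a \<Rightarrow> 'a \<Rightarrow> bool" where
  "step G u v \<longleftrightarrow> u = v \<or> v \<in> neighbours G u"

text \<open>Homomorphisms are those of reflexive graphs: an edge may be collapsed to a vertex.\<close>

definition graph_hom :: "'a pair_pre_digraph \<Rightarrow> 'b pair_pre_digraph \<Rightarrow> ('a \<Rightarrow> 'b) \<Rightarrow> bool" where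
  "graph_hom G H f \<longleftrightarrow>
     (\<forall>u\<in>pverts G. f u \<in> pverts H) \<and> (\<forall>(u, v)\<in>parcs G. step H (f u) (f v))"

definition retract_of :: "'a pair_pre_digraph \<Rightarrow> 'a pair_pre_digraph \<Rightarrow> bool" where
  "retract_of H G \<longleftrightarrow> (\<exists>f. graph_hom G H f \<and> (\<forall>x\<in>pverts H. f x = x))"

text \<open>
  The \<open>k\<close> cops are numbered \<open>0, \<dots>, k - 1\<close>; a position of the cops assigns a vertex to each number
  below \<open>k\<close>. A strategy of the cops maps the list of all robber positions so far to the next
  position of the cops: \<open>S []\<close> is their initial placement, and \<open>S [r\<^sub>0, \<dots>, r\<^sub>n]\<close> is their position
  after the move that answers \<open>r\<^sub>n\<close>. The earlier positions of the cops need not be recorded in the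
  history, since they are determined by \<open>S\<close> and the robber positions.
\<close>

type_synonym 'a cop_strategy = "'a list \<Rightarrow> nat \<Rightarrow> 'a"

definition occupied :: "nat \<Rightarrow> (nat \<Rightarrow> 'a) \<Rightarrow> 'a set" where
  "occupied k c = c ` {..<k}"

text \<open>
  Legality is imposed for all lists of vertices, not only for those the robber can actually produce;
  this is no restriction, since the cops can stay put on the remaining ones.
\<close>

definition legal_strategy :: "'a pair_pre_digraph \<Rightarrow> nat \<Rightarrow> 'a cop_strategy \<Rightarrow> bool" where
  "legal_strategy G k S \<longleftrightarrow>
     (\<forall>i<k. S [] i \<in> pverts G) \<and>
     (\<forall>h\<in>lists (pverts G). \<forall>r\<in>pverts G. \<forall>i<k. step G (S h i) (S (h @ [r]) i))"

text \<open>
  The robber positions before his \<open>n\<close>-th position are listed by \<open>map r [0..<n]\<close>. Position \<open>r n\<close>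
  is chosen when the cops stand on \<open>S (map r [0..<n])\<close>; they then move to
  \<open>S (map r [0..<Suc n])\<close>, possibly onto the robber, who must then leave.
\<close>

definition robber_play :: "'a pair_pre_digraph \<Rightarrow> nat \<Rightarrow> 'a cop_strategy \<Rightarrow> (nat \<Rightarrow> 'a) \<Rightarrow> bool" where
  "robber_play G k S r \<longleftrightarrow>
     r 0 \<in> pverts G \<and>
     (\<forall>n. step G (r n) (r (Suc n))) \<and>
     (\<forall>n. r n \<notin> occupied k (S (map r [0..<n])))"

definition surrounded :: "'a pair_pre_digraph \<Rightarrow> nat \<Rightarrow> (nat \<Rightarrow> 'a) \<Rightarrow> 'a \<Rightarrow> bool" where
  "surrounded G k c v \<longleftrightarrow> neighbours G v \<subseteq> occupied k c"

text \<open>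
  The robber wins a play if it goes on forever and he is never surrounded, neither after one of his
  own moves nor after one of the cops' moves. Plays that get stuck need no separate treatment: a
  robber without a legal move is surrounded, and if there is no vertex on which he can start then
  the cops win.
\<close>

definition robber_escapes :: "'a pair_pre_digraph \<Rightarrow> nat \<Rightarrow> 'a cop_strategy \<Rightarrow> (nat \<Rightarrow> 'a) \<Rightarrow> bool" where
  "robber_escapes G k S r \<longleftrightarrow>
     robber_play G k S r \<and>
     (\<forall>n. \<not> surrounded G k (S (map r [0..<n])) (r n) \<and>
          \<not> surrounded G k (S (map r [0..<Suc n])) (r n))"

definition cops_win :: "'a pair_pre_digraph \<Rightarrow> nat \<Rightarrow> bool" where
  "cops_win G k \<longleftrightarrow> (\<exists>S. legal_strategy G k S \<and> (\<nexists>r. robber_escapes G k S r))"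

definition surrounding_cop_number :: "'a pair_pre_digraph \<Rightarrow> nat" where
  "surrounding_cop_number G = (LEAST k. k \<ge> 1 \<and> cops_win G k)"

end

theory Submission
  imports Defs
begin

text \<open>
  The cops on \<open>H\<close> follow the images under the retraction \<open>f\<close> of the cops of a winning strategy on
  \<open>G\<close>. Since \<open>f\<close> fixes \<open>H\<close>, a vertex of \<open>H\<close> occupied by a cop on \<open>G\<close> is also occupied by the image of
  that cop. So a robber escaping on \<open>H\<close> from the images escapes on \<open>G\<close> from the original cops.
\<close>

lemma graph_hom_step:
  assumes "graph_hom G H f" and "step G u v"
  shows "step H (f u) (f v)"
  using assms unfolding graph_hom_def step_def neighbours_def by blast

text \<open>A history of robber positions in \<open>H\<close> is also one in \<open>G\<close>, so
  \<open>S\<close> can be consulted on it directly. When \<open>f\<close> collapses the edge along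
  which a cop moves, the image cop stays put, which \<open>step\<close> allows.\<close>

lemma legal_strategy_hom:
  assumes "graph_hom G H f" and "pverts H \<subseteq> pverts G" and "legal_strategy G k S"
  shows "legal_strategy H k (\<lambda>h. f \<circ> S h)"
  unfolding legal_strategy_def
proof (intro conjI allI ballI impI)
  fix i assume "i < k"
  then show "(f \<circ> S []) i \<in> pverts H"
    using assms(1,3) unfolding graph_hom_def legal_strategy_def by simp
next
  fix h r i assume "h \<in> lists (pverts H)" "r \<in> pverts H" "i < k"
  then have "step G (S h i) (S (h @ [r]) i)"
    using assms(2,3) unfolding legal_strategy_def by blast
  then show "step H ((f \<circ> S h) i) ((f \<circ> S (h @ [r])) i)"
    using graph_hom_step[OF assms(1)] by simp
qed

lemma occupied_image:
  assumes "\<forall>x\<in>A. f x = x"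
  shows "A \<inter> occupied k c \<subseteq> occupied k (f \<circ> c)"
proof
  fix x assume x: "x \<in> A \<inter> occupied k c"
  then obtain i where "i < k" "x = c i" unfolding occupied_def by auto
  moreover have "f x = x" using x assms by simp
  ultimately show "x \<in> occupied k (f \<circ> c)"
    unfolding occupied_def by (metis comp_apply image_eqI lessThan_iff)
qed

text \<open>Only the start is required to be a vertex; arcs of a well-formed graph never lead
  outside. This is what makes \<open>f\<close> fix every position of a robber on
  \<open>H\<close>.\<close>

lemma robber_play_in_verts:
  assumes "pair_wf_digraph G" and "robber_play G k S r"
  shows "r n \<in> pverts G"
proof (induction n)
  case 0
  then show ?case using assms(2) unfolding robber_play_def by simp
next
  case (Suc n)
  have "step G (r n) (r (Suc n))" using assms(2) unfolding robber_play_def by simp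
  then show ?case
    using Suc pair_wf_digraph.in_arcsD2[OF assms(1)] unfolding step_def neighbours_def by auto
qed

lemma robber_escapes_retract:
  assumes "pair_wf_digraph H" and "pverts H \<subseteq> pverts G" and "parcs H \<subseteq> parcs G"
    and "\<forall>x\<in>pverts H. f x = x"
    and "robber_escapes H k (\<lambda>h. f \<circ> S h) r"
  shows "robber_escapes G k S r"
proof -
  have play: "robber_play H k (\<lambda>h. f \<circ> S h) r"
    using assms(5) unfolding robber_escapes_def by blast
  have nbr: "neighbours H v \<subseteq> neighbours G v" "neighbours H v \<subseteq> pverts H" for v
    using assms(3) pair_wf_digraph.in_arcsD2[OF assms(1)] unfolding neighbours_def by auto
  have occ: "pverts H \<inter> occupied k c \<subseteq> occupied k (f \<circ> c)" for c
    by (rule occupied_image[OF assms(4)])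
  \<comment> \<open>Used contrapositively: the neighbours in \<open>H\<close> are among those in
    \<open>G\<close>, hence occupied by \<open>c\<close>, and being vertices of \<open>H\<close>
    they stay occupied after applying \<open>f\<close>.\<close>
  have surr: "surrounded H k (f \<circ> c) v" if "surrounded G k c v" for c v
    using that nbr[of v] occ[of c] unfolding surrounded_def by blast
  have "step G u v" if "step H u v" for u v
    using that nbr(1)[of u] unfolding step_def by blast
  then have "robber_play G k S r"
    using play assms(2) robber_play_in_verts[OF assms(1) play] occ
    unfolding robber_play_def by blast
  then show ?thesis using assms(5) surr unfolding robber_escapes_def by blast
qed

lemma cops_win_retract:
  assumes "pair_wf_digraph H" and "pverts H \<subseteq> pverts G" and "parcs H \<subseteq> parcs G"
    and "retract_of H G" and "cops_win G k"
  shows "cops_win H k"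
proof -
  obtain f where f: "graph_hom G H f" "\<forall>x\<in>pverts H. f x = x"
    using assms(4) unfolding retract_of_def by blast
  obtain S where S: "legal_strategy G k S" "\<nexists>r. robber_escapes G k S r"
    using assms(5) unfolding cops_win_def by blast
  show ?thesis
    unfolding cops_win_def
    using legal_strategy_hom[OF f(1) assms(2) S(1)] S(2)
      robber_escapes_retract[OF assms(1-3) f(2)] by blast
qed

text \<open>One motionless cop on each vertex leaves the robber nowhere to start. This ensures that
  on a nonempty graph the least number is attained.\<close>

lemma cops_win_card:
  assumes "finite (pverts G)"
  shows "cops_win G (card (pverts G))"
proof -
  obtain c where c: "c ` {..<card (pverts G)} = pverts G"
    using ex_bij_betw_nat_finite[OF assms] unfolding bij_betw_def atLeast0LessThan by blast
  have "legal_strategy G (card (pverts G)) (\<lambda>_. c)"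
    using c unfolding legal_strategy_def step_def by auto
  moreover have "\<not> robber_escapes G (card (pverts G)) (\<lambda>_. c) r" for r
    using c unfolding robber_escapes_def robber_play_def occupied_def by auto
  ultimately show ?thesis unfolding cops_win_def by blast
qed

text \<open>Cop \<open>0\<close> exists and would need a starting vertex.\<close>

lemma not_cops_win_empty:
  assumes "pverts G = {}" and "k \<ge> 1"
  shows "\<not> cops_win G k"
  using assms unfolding cops_win_def legal_strategy_def by (auto simp: Suc_le_eq)

theorem theorem6:
  fixes G H :: "'a pair_pre_digraph"
  assumes "pair_graph G" and "pair_graph H"
    and "subgraph H G"
    and "retract_of H G"
  shows "surrounding_cop_number H \<le> surrounding_cop_number G"
proof -
  interpret G: pair_graph G by fact
  interpret H: pair_graph H by fact
  have sub: "pverts H \<subseteq> pverts G" "parcs H \<subseteq> parcs G"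
    using assms(3) by (auto simp: subgraph_def)
  show ?thesis
  proof (cases "pverts G = {}")
    case True
    \<comment> \<open>On the empty graph no number of cops wins, and both sides are the same junk value.\<close>
    then have "pverts H = {}" using sub by blast
    with True have "(k \<ge> 1 \<and> cops_win H k) \<longleftrightarrow> (k \<ge> 1 \<and> cops_win G k)" for k
      using not_cops_win_empty by blast
    then show ?thesis unfolding surrounding_cop_number_def by simp
  next
    case False
    then have "card (pverts G) \<ge> 1 \<and> cops_win G (card (pverts G))"
      using cops_win_card[OF G.pair_finite_verts] by (simp add: Suc_le_eq card_gt_0_iff)
    \<comment> \<open>The minimum itself is a winning number on \<open>G\<close>; it then wins on
      \<open>H\<close> too and so bounds the minimum there.\<close>
    then have "surrounding_cop_number G \<ge> 1 \<and> cops_win G (surrounding_cop_number G)"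
      unfolding surrounding_cop_number_def by (rule LeastI)
    then show ?thesis
      using cops_win_retract[OF H.pair_wf_digraph_axioms sub assms(4)]
      unfolding surrounding_cop_number_def[of H] by (blast intro: Least_le)
  qed
qed

end
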